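(* As formal power series in $q$ (equivalently, for complex $q$ with $|q|<1$), $$\sum_{n\ge 0}\frac{q^{2n^2}}{(q;q)_{2n}}=\frac{1}{(q;q)_\infty}\sum_{k\in\mathbb{Z}}\left(q^{12k^2+k}-q^{12k^2+7k+1}\right).$$
   Context: $(q;q)_n=\prod_{j=1}^{n}(1-q^j)$ and $(q;q)_\infty=\prod_{j\ge1}(1-q^j)$. *)

theory Defs
  imports "HOL-Analysis.Analysis" "HOL-Computational_Algebra.Formal_Power_Series"
begin

definition qfact :: "'a::comm_ring_1 \<Rightarrow> nat \<Rightarrow> 'a"
  where "qfact q n = (\<Prod>j=1..n. 1 - q ^ j)"

text \<open>
  The product over \<open>j \<ge> 1\<close>, indexed from 0 as \<^const>\<open>prodinf\<close> requires.
  For formal power series, infinite products and sums refer to the library's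
  \<open>q\<close>-adic metric on \<^typ>\<open>complex fps\<close>.
\<close>
definition qfact_inf :: "'a::{comm_ring_1, t2_space} \<Rightarrow> 'a"
  where "qfact_inf q = (\<Prod>j. 1 - q ^ Suc j)"

text \<open>
  Both exponents are nonnegative for every integer \<open>k\<close>, so \<^const>\<open>nat\<close> never truncates here.
\<close>
definition theta_term :: "'a::comm_ring_1 \<Rightarrow> int \<Rightarrow> 'a"
  where "theta_term q k = q ^ nat (12 * k\<^sup>2 + k) - q ^ nat (12 * k\<^sup>2 + 7 * k + 1)"

end

(*
  Put q = p^2.  Since (-p;-p)_{2n} = (q;q)_n prod_{j<n} (1 + p^(2j+1)), the q-binomial theorem
  expands (-p;-p)_{2n} / (q;q)_n as the sum over k of p^(k^2) times a Gaussian binomial coefficient.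
  Averaging over p and -p keeps the even k, whose terms tend to q^(2m^2) / (q;q)_{2m}, k = 2m.
  On the other hand (p;p)_{4M} is a partial sum of Euler's pentagonal number series up to an error
  divisible by p^(4M) (Shanks' identity), and the even part of that series is the theta series in q.
  The resulting polynomial identity has an error tending to 0 both for |q| < 1 and q-adically.
  For formal power series, p = X yields the identity with X^2 in place of q, and q is recovered by
  comparing even coefficients.
*)
theory Submission
  imports Defs "HOL-Library.Nat_Bijection"
begin

unbundle no vec_syntax
unbundle fps_syntax

subsection \<open>Gaussian binomial coefficients\<close>

lemma qfact_0 [simp]: "qfact q 0 = 1"
  by (simp add: qfact_def)

lemma qfact_Suc [simp]: "qfact q (Suc n) = qfact q n * (1 - q ^ Suc n)"
  by (simp add: qfact_def)

lemma qfact_eq_prod_lessThan: "qfact q n = (\<Prod>j<n. 1 - q ^ Suc j)"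
  by (induction n) simp_all

text \<open>The q-Pascal rule replaces the quotient of \<open>qfact\<close>s, so that the
  coefficient exists in every commutative ring and commutes with substitution. For
  \<open>k > n\<close> the truncated \<open>n - k\<close> is harmless, as it multiplies
  zero.\<close>

fun qbinomial :: "'a::comm_ring_1 \<Rightarrow> nat \<Rightarrow> nat \<Rightarrow> 'a" where
  "qbinomial q n 0 = 1"
| "qbinomial q 0 (Suc k) = 0"
| "qbinomial q (Suc n) (Suc k) = qbinomial q n (Suc k) + q ^ (n - k) * qbinomial q n k"

lemma qbinomial_eq_0: "n < k \<Longrightarrow> qbinomial q n k = 0"
  by (induction q n k rule: qbinomial.induct) simp_all

text \<open>The two terms of the q-Pascal rule contribute the factors \<open>1 - q ^ (n - j)\<close>
  and \<open>q ^ (n - j) * (1 - q ^ Suc j)\<close>, which add up to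
  \<open>1 - q ^ Suc n\<close>.\<close>

lemma qbinomial_qfact:
  "k \<le> n \<Longrightarrow> qbinomial q n k * qfact q k * qfact q (n - k) = qfact q n"
proof (induction n arbitrary: k)
  case 0
  then show ?case by simp
next
  case (Suc n)
  show ?case
  proof (cases k)
    case 0
    then show ?thesis by simp
  next
    case (Suc j)
    with Suc.prems have j: "j \<le> n" by simp
    have IH: "qbinomial q n j * qfact q j * qfact q (n - j) = qfact q n"
      by (rule Suc.IH[OF j])
    have IH': "qbinomial q n (Suc j) * qfact q (Suc j) * qfact q (n - j) = (1 - q ^ (n - j)) * qfact q n"
    proof (cases "j = n")
      case True
      then show ?thesis by (simp add: qbinomial_eq_0)
    next
      case False
      with j obtain d where d: "n = Suc j + d"
        by (metis Suc_leI le_add_diff_inverse le_neq_implies_less)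
      have "qbinomial q n (Suc j) * qfact q (Suc j) * qfact q d = qfact q n"
        using Suc.IH[of "Suc j"] d by simp
      then have "(1 - q ^ Suc d) * qfact q n =
          qbinomial q n (Suc j) * qfact q (Suc j) * (qfact q d * (1 - q ^ Suc d))"
        by (metis mult.assoc mult.commute)
      then show ?thesis using d by simp
    qed
    have "qbinomial q (Suc n) (Suc j) * qfact q (Suc j) * qfact q (n - j) =
        qbinomial q n (Suc j) * qfact q (Suc j) * qfact q (n - j) +
        q ^ (n - j) * (1 - q ^ Suc j) * (qbinomial q n j * qfact q j * qfact q (n - j))"
      by (simp add: algebra_simps)
    also have "\<dots> = (1 - q ^ (n - j) * q ^ Suc j) * qfact q n"
      unfolding IH IH' by (simp add: algebra_simps)
    also have "q ^ (n - j) * q ^ Suc j = q ^ Suc n"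
      using j by (simp flip: power_add del: power_Suc)
    finally show ?thesis using \<open>k = Suc j\<close> by (simp add: mult_ac)
  qed
qed

text \<open>Multiplying by the factor \<open>1 + p ^ (2 * n + 1)\<close> matches the q-Pascal rule
  in base \<open>p^2\<close>, because (k+1)^2 + 2(n-k) = (2n+1) + k^2.\<close>

lemma qbinomial_theorem_odd_powers:
  fixes p :: "'a::comm_ring_1"
  shows "(\<Prod>j<n. 1 + p ^ (2 * j + 1)) = (\<Sum>k\<le>n. p ^ k\<^sup>2 * qbinomial (p\<^sup>2) n k)"
proof (induction n)
  case 0
  then show ?case by simp
next
  case (Suc n)
  have step: "p ^ (Suc k)\<^sup>2 * qbinomial (p\<^sup>2) (Suc n) (Suc k) =
      p ^ (Suc k)\<^sup>2 * qbinomial (p\<^sup>2) n (Suc k) + p ^ (2 * n + 1) * (p ^ k\<^sup>2 * qbinomial (p\<^sup>2) n k)"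
    if "k \<le> n" for k
  proof -
    obtain d where "n = k + d" using \<open>k \<le> n\<close> le_Suc_ex by blast
    then have "p ^ (Suc k)\<^sup>2 * (p\<^sup>2) ^ (n - k) = p ^ (2 * n + 1) * p ^ k\<^sup>2"
      unfolding power_mult[symmetric] power_add[symmetric]
      by (intro arg_cong[where f = "\<lambda>e. p ^ e"]) (simp add: power2_eq_square algebra_simps)
    then show ?thesis by (simp add: distrib_left flip: mult.assoc)
  qed
  have "(\<Sum>k\<le>Suc n. p ^ k\<^sup>2 * qbinomial (p\<^sup>2) (Suc n) k) =
      1 + (\<Sum>k\<le>n. p ^ (Suc k)\<^sup>2 * qbinomial (p\<^sup>2) (Suc n) (Suc k))"
    by (subst sum.atMost_Suc_shift) simp
  also have "\<dots> = 1 + (\<Sum>k\<le>n. p ^ (Suc k)\<^sup>2 * qbinomial (p\<^sup>2) n (Suc k)) +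
      p ^ (2 * n + 1) * (\<Sum>k\<le>n. p ^ k\<^sup>2 * qbinomial (p\<^sup>2) n k)"
    by (simp add: step sum.distrib sum_distrib_left del: qbinomial.simps(3))
  also have "1 + (\<Sum>k\<le>n. p ^ (Suc k)\<^sup>2 * qbinomial (p\<^sup>2) n (Suc k)) =
      (\<Sum>k\<le>Suc n. p ^ k\<^sup>2 * qbinomial (p\<^sup>2) n k)"
    by (simp add: sum.atMost_Suc_shift del: sum.atMost_Suc)
  also have "\<dots> = (\<Sum>k\<le>n. p ^ k\<^sup>2 * qbinomial (p\<^sup>2) n k)"
    by (simp add: qbinomial_eq_0)
  finally show ?case using Suc by (simp add: algebra_simps)
qed

subsection \<open>The pentagonal number theorem\<close>

text \<open>
  \<open>(s + 1)\<^sup>2 + triangle s\<close> and \<open>(s + 1)\<^sup>2 + triangle (s + 1)\<close> are the pentagonal numbers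
  \<open>k (3 k - 1) / 2\<close> and \<open>k (3 k + 1) / 2\<close> for \<open>k = s + 1\<close>.
\<close>
definition pent_sum :: "'a::comm_ring_1 \<Rightarrow> nat \<Rightarrow> 'a" where
  "pent_sum p n = 1 + (\<Sum>s<n. (-1) ^ Suc s *
     (p ^ ((Suc s)\<^sup>2 + triangle s) + p ^ ((Suc s)\<^sup>2 + triangle (Suc s))))"

text \<open>Passing from \<open>n\<close> to \<open>n + 1\<close> changes the partial sums over
  \<open>s\<close> by a single boundary term (\<open>tele\<close>). At \<open>m = n\<close> this
  term and the new summand \<open>s = n + 1\<close> are the next two pentagonal powers.\<close>

lemma shanks_identity:
  fixes p :: "'a::comm_ring_1"
  shows "(\<Sum>s\<le>n. (-1) ^ s * (\<Prod>j\<in>{s<..n}. 1 - p ^ j) * p ^ (s * n + triangle s)) = pent_sum p n"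
proof (induction n)
  case 0
  then show ?case by (simp add: pent_sum_def)
next
  case (Suc n)
  define Q where "Q s m = (\<Prod>j\<in>{s<..m}. 1 - p ^ j)" for s m
  have Q_right: "Q s (Suc n) = Q s n * (1 - p ^ Suc n)" if "s \<le> n" for s
  proof -
    have "{s<..Suc n} = insert (Suc n) {s<..n}" using that by auto
    then show ?thesis by (simp add: Q_def mult.commute)
  qed
  have Q_left: "Q s n = (1 - p ^ Suc s) * Q (Suc s) n" if "s < n" for s
  proof -
    have "{s<..n} = insert (Suc s) {Suc s<..n}" using that by auto
    then show ?thesis by (simp add: Q_def)
  qed
  have tele: "(\<Sum>s\<le>m. (-1) ^ s * Q s (Suc n) * p ^ (s * Suc n + triangle s)) =
      (\<Sum>s\<le>m. (-1) ^ s * Q s n * p ^ (s * n + triangle s)) -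
      (-1) ^ m * Q m n * p ^ (Suc m * Suc n + triangle m)" if "m \<le> n" for m
    using that
  proof (induction m)
    case 0
    then show ?case by (simp add: Q_right algebra_simps)
  next
    case (Suc m)
    have e: "p ^ (Suc m * n + triangle (Suc m)) = p ^ (Suc m * Suc n + triangle m)"
      by (simp add: algebra_simps)
    have e2: "p ^ (Suc m * Suc n + triangle (Suc m)) = p ^ Suc m * p ^ (Suc m * Suc n + triangle m)"
      by (simp add: algebra_simps flip: power_add power_Suc)
    have e3: "p ^ (Suc (Suc m) * Suc n + triangle (Suc m)) =
        p ^ Suc n * p ^ Suc m * p ^ (Suc m * Suc n + triangle m)"
      by (simp add: algebra_simps flip: power_add power_Suc)
    have Q1: "Q (Suc m) (Suc n) = Q (Suc m) n * (1 - p ^ Suc n)" and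
      Q2: "Q m n = (1 - p ^ Suc m) * Q (Suc m) n"
      using Suc.prems by (simp_all only: Q_right Q_left Suc_le_eq)
    have IH: "(\<Sum>s\<le>m. (-1) ^ s * Q s (Suc n) * p ^ (s * Suc n + triangle s)) =
      (\<Sum>s\<le>m. (-1) ^ s * Q s n * p ^ (s * n + triangle s)) -
      (-1) ^ m * Q m n * p ^ (Suc m * Suc n + triangle m)"
      using Suc by simp
    \<comment> \<open>Up to sign, all terms that remain are multiples of
      \<open>Q (Suc m) n * u\<close>. With a = \<open>p ^ Suc m\<close> and b =
      \<open>p ^ Suc n\<close> the claim becomes (1 - a) + (1 - b) a = 1 - a b.\<close>
    define u where "u = p ^ (Suc m * Suc n + triangle m)"
    show ?case
      unfolding sum.atMost_Suc IH e e2 e3 Q1 Q2 u_def[symmetric]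
      by (simp add: algebra_simps)
  qed
  have "(\<Sum>s\<le>Suc n. (-1) ^ s * Q s (Suc n) * p ^ (s * Suc n + triangle s)) =
      pent_sum p n - (-1) ^ n * p ^ (Suc n * Suc n + triangle n) +
      (-1) ^ Suc n * p ^ (Suc n * Suc n + triangle (Suc n))"
    using tele[of n] Suc by (simp add: Q_def)
  also have "\<dots> = pent_sum p (Suc n)"
    by (simp add: pent_sum_def power2_eq_square algebra_simps)
  finally show ?case by (simp add: Q_def)
qed

text \<open>The summands \<open>s >= 1\<close> of Shanks' sum with opposite sign; the summand
  \<open>s = 0\<close> is \<open>qfact p n\<close> itself.\<close>

definition pent_err :: "'a::comm_ring_1 \<Rightarrow> nat \<Rightarrow> 'a" where
  "pent_err p n = (\<Sum>s\<in>{1..n}. (-1) ^ Suc s * (\<Prod>j\<in>{s<..n}. 1 - p ^ j) * p ^ (s * n + triangle s))"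

lemma qfact_eq_pent_sum: "qfact p n = pent_sum p n + pent_err p n"
proof -
  have "{..n} = insert 0 {1..n}" by auto
  moreover have "{0<..n} = {1..n}" by auto
  ultimately have "pent_sum p n = qfact p n - pent_err p n"
    by (simp add: qfact_def pent_err_def sum_negf flip: shanks_identity)
  then show ?thesis by simp
qed

text \<open>The error estimate in the formal setting: \<open>s >= 1\<close> makes every exponent at
  least \<open>n\<close>.\<close>

lemma power_dvd_pent_err: "p ^ n dvd pent_err p n"
  unfolding pent_err_def
proof (intro dvd_sum dvd_mult le_imp_power_dvd)
  fix s assume "s \<in> {1..n}"
  then show "n \<le> s * n + triangle s" by (cases s) auto
qed

text \<open>
  Only \<open>k = 0\<close> and \<open>k = 1\<close> modulo 4 give even numbers \<open>k (3 k + 1) / 2\<close>. The cut-off at \<open>\<bar>k\<bar> \<le> 4 M\<close> misses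
  \<open>k = 4 M + 1\<close>, whence the last summand.
\<close>
lemma pent_sum_even_part:
  fixes p :: "'a::comm_ring_1"
  shows "pent_sum p (4 * M) + pent_sum (- p) (4 * M) =
    2 * ((\<Sum>j\<in>{- int M..int M}. theta_term (p\<^sup>2) j) + p ^ (2 * (12 * M\<^sup>2 + 7 * M + 1)))"
proof (induction M)
  case 0
  then show ?case by (simp add: pent_sum_def theta_term_def)
next
  case (Suc M)
  have tri: "triangle (4 * M) = 8 * M\<^sup>2 + 2 * M"
    by (simp add: triangle_def power2_eq_square algebra_simps)
  have add_Suc_eqs: "4 * M + 1 = Suc (4 * M)" "4 * M + 2 = Suc (Suc (4 * M))"
    "4 * M + 3 = Suc (Suc (Suc (4 * M)))"
    by simp_all
  define inc where "inc = (\<lambda>(x::'a) s. (-1) ^ Suc s *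
    (x ^ ((Suc s)\<^sup>2 + triangle s) + x ^ ((Suc s)\<^sup>2 + triangle (Suc s))))"
  have pent: "pent_sum x (4 * Suc M) = pent_sum x (4 * M) +
      inc x (4 * M) + inc x (4 * M + 1) + inc x (4 * M + 2) + inc x (4 * M + 3)" for x
    unfolding pent_sum_def inc_def by (simp add: eval_nat_numeral)
  have E: "(Suc (4 * M))\<^sup>2 + triangle (4 * M) = 2 * (12 * M\<^sup>2 + 5 * M) + 1"
    "(Suc (4 * M))\<^sup>2 + triangle (Suc (4 * M)) = 2 * (12 * M\<^sup>2 + 7 * M + 1)"
    "(Suc (4 * M + 1))\<^sup>2 + triangle (4 * M + 1) = 2 * (12 * M\<^sup>2 + 11 * M + 2) + 1"
    "(Suc (4 * M + 1))\<^sup>2 + triangle (Suc (4 * M + 1)) = 2 * (12 * M\<^sup>2 + 13 * M + 3) + 1"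
    "(Suc (4 * M + 2))\<^sup>2 + triangle (4 * M + 2) = 2 * (12 * M\<^sup>2 + 17 * M + 6)"
    "(Suc (4 * M + 2))\<^sup>2 + triangle (Suc (4 * M + 2)) = 2 * (12 * M\<^sup>2 + 19 * M + 7) + 1"
    "(Suc (4 * M + 3))\<^sup>2 + triangle (4 * M + 3) = 2 * (12 * M\<^sup>2 + 23 * M + 11)"
    "(Suc (4 * M + 3))\<^sup>2 + triangle (Suc (4 * M + 3)) = 2 * (12 * M\<^sup>2 + 25 * M + 13)"
    by (simp_all only: add_Suc_eqs triangle_Suc tri) (simp_all add: power2_eq_square algebra_simps)
  \<comment> \<open>Between \<open>p\<close> and \<open>- p\<close> odd exponents cancel and even
    ones double; four of the eight exponents in \<open>E\<close> are even.\<close>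
  have inc_sum: "inc p (4 * M) + inc (- p) (4 * M) = - 2 * p ^ (2 * (12 * M\<^sup>2 + 7 * M + 1))"
    "inc p (4 * M + 1) + inc (- p) (4 * M + 1) = 0"
    "inc p (4 * M + 2) + inc (- p) (4 * M + 2) = - 2 * p ^ (2 * (12 * M\<^sup>2 + 17 * M + 6))"
    "inc p (4 * M + 3) + inc (- p) (4 * M + 3) =
      2 * (p ^ (2 * (12 * M\<^sup>2 + 23 * M + 11)) + p ^ (2 * (12 * M\<^sup>2 + 25 * M + 13)))"
    unfolding inc_def E by (simp_all add: power_add power_mult)
  have nat_e: "nat (12 * (int (Suc M))\<^sup>2 + int (Suc M)) = 12 * M\<^sup>2 + 25 * M + 13"
    "nat (12 * (- int (Suc M))\<^sup>2 + (- int (Suc M))) = 12 * M\<^sup>2 + 23 * M + 11"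
    "nat (12 * (int (Suc M))\<^sup>2 + 7 * int (Suc M) + 1) = 12 * (Suc M)\<^sup>2 + 7 * Suc M + 1"
    "nat (12 * (- int (Suc M))\<^sup>2 + 7 * (- int (Suc M)) + 1) = 12 * M\<^sup>2 + 17 * M + 6"
    by (simp_all add: nat_eq_iff power2_eq_square algebra_simps)
  have "{- int (Suc M)..int (Suc M)} = insert (- int (Suc M)) (insert (int (Suc M)) {- int M..int M})"
    by auto
  then have "(\<Sum>j\<in>{- int (Suc M)..int (Suc M)}. theta_term (p\<^sup>2) j) =
      theta_term (p\<^sup>2) (- int (Suc M)) + (theta_term (p\<^sup>2) (int (Suc M)) +
      (\<Sum>j\<in>{- int M..int M}. theta_term (p\<^sup>2) j))"
    by simp
  also have "theta_term (p\<^sup>2) (- int (Suc M)) =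
      p ^ (2 * (12 * M\<^sup>2 + 23 * M + 11)) - p ^ (2 * (12 * M\<^sup>2 + 17 * M + 6))"
    unfolding theta_term_def nat_e by (simp only: power_mult)
  also have "theta_term (p\<^sup>2) (int (Suc M)) =
      p ^ (2 * (12 * M\<^sup>2 + 25 * M + 13)) - p ^ (2 * (12 * (Suc M)\<^sup>2 + 7 * Suc M + 1))"
    unfolding theta_term_def nat_e by (simp only: power_mult)
  finally have theta: "(\<Sum>j\<in>{- int (Suc M)..int (Suc M)}. theta_term (p\<^sup>2) j) =
      p ^ (2 * (12 * M\<^sup>2 + 23 * M + 11)) - p ^ (2 * (12 * M\<^sup>2 + 17 * M + 6)) +
      (p ^ (2 * (12 * M\<^sup>2 + 25 * M + 13)) - p ^ (2 * (12 * (Suc M)\<^sup>2 + 7 * Suc M + 1)) +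
      (\<Sum>j\<in>{- int M..int M}. theta_term (p\<^sup>2) j))" .
  \<comment> \<open>The increment at \<open>4 * M\<close> cancels the extra summand of the induction
    hypothesis; the extra summand for \<open>Suc M\<close> cancels the negative power in
    \<open>theta_term\<close> at \<open>Suc M\<close>.\<close>
  have "pent_sum p (4 * Suc M) + pent_sum (- p) (4 * Suc M) =
      (pent_sum p (4 * M) + pent_sum (- p) (4 * M)) +
      (inc p (4 * M) + inc (- p) (4 * M)) + (inc p (4 * M + 1) + inc (- p) (4 * M + 1)) +
      (inc p (4 * M + 2) + inc (- p) (4 * M + 2)) + (inc p (4 * M + 3) + inc (- p) (4 * M + 3))"
    unfolding pent by (simp only: ac_simps)
  then show ?case
    unfolding Suc inc_sum theta by (simp only: algebra_simps) simp
qed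

subsection \<open>The finite identity\<close>

text \<open>A polynomial version of the left-hand series: the Gaussian binomial will tend to
  \<open>1 / qfact q (2 * k)\<close>, and summands with \<open>2 * k > n\<close> are zero.\<close>

definition qbinomial_sum :: "'a::comm_ring_1 \<Rightarrow> nat \<Rightarrow> 'a" where
  "qbinomial_sum q n = (\<Sum>k\<le>n. q ^ (2 * k\<^sup>2) * qbinomial q n (2 * k))"

text \<open>Factors with even exponent form \<open>qfact (p^2) n\<close>; in those with odd exponent
  the sign of \<open>- p\<close> turns minus into plus.\<close>

lemma qfact_uminus: "qfact (- p) (2 * n) = qfact (p\<^sup>2) n * (\<Prod>j<n. 1 + p ^ (2 * j + 1))"
proof (induction n)
  case (Suc n)
  have "qfact (- p) (2 * Suc n) = qfact (- p) (2 * n) * (1 + p ^ (2 * n + 1)) * (1 - p ^ (2 * n + 2))"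
    by simp
  also have "p ^ (2 * n + 2) = (p\<^sup>2) ^ Suc n"
    unfolding power_mult[symmetric] by simp
  finally show ?case
    unfolding Suc prod.lessThan_Suc qfact_Suc by (simp only: mult_ac)
qed simp

text \<open>Since k^2 has the parity of k, adding the expansions at \<open>p\<close> and
  \<open>- p\<close> doubles the terms with even k and removes the others.\<close>

lemma qfact_even_part:
  fixes p :: "'a::comm_ring_1"
  shows "qfact p (2 * n) + qfact (- p) (2 * n) = 2 * (qfact (p\<^sup>2) n * qbinomial_sum (p\<^sup>2) n)"
proof -
  have eq: "qfact (- x) (2 * n) = qfact (p\<^sup>2) n * (\<Sum>k\<le>n. x ^ k\<^sup>2 * qbinomial (p\<^sup>2) n k)"
    if "x\<^sup>2 = p\<^sup>2" for x :: 'a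
    unfolding qfact_uminus qbinomial_theorem_odd_powers that ..
  have "(\<Sum>k\<le>n. (- p) ^ k\<^sup>2 * qbinomial (p\<^sup>2) n k) + (\<Sum>k\<le>n. p ^ k\<^sup>2 * qbinomial (p\<^sup>2) n k) =
      (\<Sum>k\<le>n. if even k then 2 * (p ^ k\<^sup>2 * qbinomial (p\<^sup>2) n k) else 0)"
    unfolding sum.distrib[symmetric] by (intro sum.cong) auto
  \<comment> \<open>The image reaches up to \<open>2 * n\<close>, but the binomials beyond
    \<open>n\<close> vanish.\<close>
  also have "\<dots> = (\<Sum>k\<in>(\<lambda>k. 2 * k) ` {..n}. 2 * (p ^ k\<^sup>2 * qbinomial (p\<^sup>2) n k))"
  proof (intro sum.mono_neutral_cong)
    fix k assume "k \<in> {..n} - (\<lambda>k. 2 * k) ` {..n}"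
    then have "odd k"
      by (metis DiffE atMost_iff dvdE dvd_imp_le gr0I imageI le_trans mult_0_right mult_le_mono2 le_add1 mult_2)
    then show "(if even k then 2 * (p ^ k\<^sup>2 * qbinomial (p\<^sup>2) n k) else 0) = 0" by simp
  qed (auto simp: qbinomial_eq_0)
  also have "\<dots> = 2 * qbinomial_sum (p\<^sup>2) n"
    by (simp add: sum.reindex inj_on_def qbinomial_sum_def sum_distrib_left power_mult_distrib
        flip: power_mult)
  finally show ?thesis
    using eq[of p] eq[of "- p"] by (simp add: algebra_simps flip: distrib_left)
qed

text \<open>The error in the identity after clearing \<open>qfact_inf\<close>. The index
  \<open>2 * M\<close> corresponds to \<open>qfact p (4 * M)\<close> for \<open>q = p^2\<close>,
  matching the blocks of four in \<open>pent_sum_even_part\<close>.\<close>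

definition theta_defect :: "'a::comm_ring_1 \<Rightarrow> nat \<Rightarrow> 'a" where
  "theta_defect q M = qfact q (2 * M) * qbinomial_sum q (2 * M) - (\<Sum>j\<in>{- int M..int M}. theta_term q j)"

text \<open>Reduces the defect to terms that are small in both settings. The factor 2 stems from
  adding the values at \<open>p\<close> and \<open>- p\<close>; it cannot be cancelled in a general
  commutative ring.\<close>

lemma theta_defect_eq:
  "2 * theta_defect (p\<^sup>2) M =
     2 * p ^ (2 * (12 * M\<^sup>2 + 7 * M + 1)) + pent_err p (4 * M) + pent_err (- p) (4 * M)"
proof -
  have "2 * theta_defect (p\<^sup>2) M =
      qfact p (4 * M) + qfact (- p) (4 * M) - 2 * (\<Sum>j\<in>{- int M..int M}. theta_term (p\<^sup>2) j)"
    using qfact_even_part[of p "2 * M"] by (simp add: theta_defect_def right_diff_distrib)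
  also have "\<dots> = pent_sum p (4 * M) + pent_sum (- p) (4 * M) + pent_err p (4 * M) + pent_err (- p) (4 * M)
      - 2 * (\<Sum>j\<in>{- int M..int M}. theta_term (p\<^sup>2) j)"
    by (simp add: qfact_eq_pent_sum)
  finally show ?thesis
    unfolding pent_sum_even_part by (simp add: algebra_simps)
qed

subsection \<open>Limits for complex numbers\<close>

text \<open>Links unordered summation over the integers to the symmetric partial sums in
  \<open>theta_defect\<close>.\<close>

lemma filterlim_symmetric_int_intervals:
  "filterlim (\<lambda>M. {- int M..int M}) (finite_subsets_at_top UNIV) sequentially"
  unfolding filterlim_iff eventually_finite_subsets_at_top
proof safe
  fix P :: "int set \<Rightarrow> bool" and X :: "int set"
  assume X: "finite X" and P: "\<forall>Y. finite Y \<and> X \<subseteq> Y \<and> Y \<subseteq> UNIV \<longrightarrow> P Y"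
  \<comment> \<open>Inserting 0 keeps \<open>Max\<close> meaningful for empty
    \<open>X\<close>.\<close>
  have "X \<subseteq> {- int M..int M}" if "nat (Max (insert 0 (abs ` X))) \<le> M" for M
  proof
    fix x assume "x \<in> X"
    then have "\<bar>x\<bar> \<le> Max (insert 0 (abs ` X))"
      using X by (intro Max_ge) auto
    with that show "x \<in> {- int M..int M}" by auto
  qed
  with P show "eventually (\<lambda>M. P {- int M..int M}) sequentially"
    unfolding eventually_sequentially by blast
qed

lemma summable_on_imp_symmetric_limit:
  fixes f :: "int \<Rightarrow> 'a::{comm_monoid_add, t2_space}"
  assumes "f summable_on UNIV"
  shows "(\<lambda>M. \<Sum>j\<in>{- int M..int M}. f j) \<longlonglongrightarrow> infsum f UNIV"
  using assms filterlim_compose[OF _ filterlim_symmetric_int_intervals]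
  unfolding summable_iff_has_sum_infsum has_sum_def by blast

text \<open>Gives the geometric majorant over the complex numbers and the finiteness of each
  coefficient for power series. It rests on |k| <= k^2 for integers.\<close>

lemma abs_le_theta_exponents:
  fixes k :: int
  shows "nat \<bar>k\<bar> \<le> nat (12 * k\<^sup>2 + k)" and "nat \<bar>k\<bar> \<le> nat (12 * k\<^sup>2 + 7 * k + 1)"
proof -
  have "\<bar>k\<bar> \<le> k\<^sup>2"
    using mult_left_mono[of 1 "\<bar>k\<bar>" "\<bar>k\<bar>"] by (cases "k = 0") (auto simp: power2_eq_square)
  then show "nat \<bar>k\<bar> \<le> nat (12 * k\<^sup>2 + k)" "nat \<bar>k\<bar> \<le> nat (12 * k\<^sup>2 + 7 * k + 1)"
    by linarith+
qed

section \<open>Convergence for complex q in the open unit disc\<close>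

context
  fixes q :: complex
  assumes q: "norm q < 1"
begin

lemma qfact_nonzero_complex: "qfact q n \<noteq> 0"
proof (induction n)
  case (Suc n)
  have "norm (q ^ Suc n) < 1"
    unfolding norm_power using q by (intro power_less_one_iff[THEN iffD2]) auto
  then have "q ^ Suc n \<noteq> 1" by force
  with Suc show ?case by simp
qed simp

lemma has_prod_qfact_inf_complex:
  "(\<lambda>j. 1 - q ^ Suc j) has_prod qfact_inf q" "qfact_inf q \<noteq> 0"
proof -
  have nz: "1 - q ^ Suc j \<noteq> 0" for j
    using qfact_nonzero_complex[of "Suc j"] by simp
  have "summable (\<lambda>j. norm (- (q ^ Suc j)))"
    using q by (simp add: norm_power norm_mult summable_mult summable_geometric)
  moreover have "- (q ^ Suc j) \<noteq> - 1" for j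
    using nz[of j] by (simp del: power_Suc)
  ultimately have "convergent_prod (\<lambda>j. 1 + - (q ^ Suc j))"
    by (rule summable_imp_convergent_prod_complex)
  then have conv: "convergent_prod (\<lambda>j. 1 - q ^ Suc j)"
    by simp
  show "(\<lambda>j. 1 - q ^ Suc j) has_prod qfact_inf q"
    unfolding qfact_inf_def by (rule convergent_prod_has_prod[OF conv])
  show "qfact_inf q \<noteq> 0"
    unfolding qfact_inf_def using conv nz by (rule prodinf_nonzero)
qed

lemma tendsto_qfact_complex: "qfact q \<longlonglongrightarrow> qfact_inf q"
  using has_prod_imp_tendsto'[OF has_prod_qfact_inf_complex(1)]
  by (simp add: qfact_eq_prod_lessThan[abs_def])

text \<open>Both sequences converge because the infinite product is not zero. The common bound
  controls tail products and Gaussian binomials.\<close>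

lemma bounded_qfact_complex:
  obtains B where "B > 0" "\<And>n. norm (qfact q n) \<le> B" "\<And>n. norm (inverse (qfact q n)) \<le> B"
proof -
  have "Bseq (qfact q)" "Bseq (\<lambda>n. inverse (qfact q n))"
    using tendsto_qfact_complex tendsto_inverse[OF tendsto_qfact_complex has_prod_qfact_inf_complex(2)]
    by (auto intro: convergent_imp_Bseq convergentI)
  then obtain B C where "B > 0" "\<And>n. norm (qfact q n) \<le> B" "\<And>n. norm (inverse (qfact q n)) \<le> C"
    by (elim BseqE) blast
  then show ?thesis
    by (intro that[of "max B C"]) (auto intro: le_max_iff_disj[THEN iffD2])
qed

text \<open>Each tail product is a quotient of two \<open>qfact\<close>s, so each of the
  \<open>n\<close> summands is at most a constant times \<open>norm q ^ n\<close>, and n |q|^n tends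
  to 0.\<close>

lemma tendsto_pent_err_complex: "pent_err q \<longlonglongrightarrow> 0"
proof -
  obtain B where B: "B > 0" "\<And>n. norm (qfact q n) \<le> B" "\<And>n. norm (inverse (qfact q n)) \<le> B"
    using bounded_qfact_complex by metis
  have tail: "norm (\<Prod>j\<in>{s<..n}. 1 - q ^ j) \<le> B * B" if "s \<le> n" for s n
  proof -
    have "{1..n} = {1..s} \<union> {s<..n}" using that by auto
    then have "qfact q n = qfact q s * (\<Prod>j\<in>{s<..n}. 1 - q ^ j)"
      unfolding qfact_def by (simp add: prod.union_disjoint ivl_disj_int)
    then have "(\<Prod>j\<in>{s<..n}. 1 - q ^ j) = qfact q n * inverse (qfact q s)"
      using qfact_nonzero_complex[of s] by (simp add: field_simps)
    then show ?thesis
      using B by (simp add: norm_mult mult_mono)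
  qed
  have "norm (pent_err q n) \<le> B * B * (real n * norm q ^ n)" for n
  proof -
    have "norm (pent_err q n) \<le> (\<Sum>s\<in>{1..n}. B * B * norm q ^ n)"
      unfolding pent_err_def
    proof (rule sum_norm_le)
      fix s assume s: "s \<in> {1..n}"
      then have "norm q ^ (s * n + triangle s) \<le> norm q ^ n"
        using q by (intro power_decreasing) (cases s; auto)+
      then show "norm ((-1) ^ Suc s * (\<Prod>j\<in>{s<..n}. 1 - q ^ j) * q ^ (s * n + triangle s)) \<le> B * B * norm q ^ n"
        using tail[of s n] s B(1) by (auto simp: norm_mult norm_power intro!: mult_mono)
    qed
    then show ?thesis by (simp add: mult_ac)
  qed
  moreover have "(\<lambda>n. B * B * (real n * norm q ^ n)) \<longlonglongrightarrow> 0"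
    using q by (intro tendsto_mult_right_zero powser_times_n_limit_0) simp
  ultimately show ?thesis
    by (intro Lim_null_comparison[of "pent_err q"]) auto
qed

text \<open>Comparison with a two-sided geometric series, summed separately over k >= 0 and k = -1 -
  n.\<close>

lemma theta_summable_complex: "theta_term q summable_on UNIV"
proof (rule abs_summable_summable, rule Infinite_Sum.abs_summable_on_comparison_test)
  define g where "g = (\<lambda>k::int. 2 * norm q ^ nat \<bar>k\<bar>)"
  have "summable (\<lambda>n. 2 * norm q ^ n)" "summable (\<lambda>n. 2 * norm q ^ Suc n)"
    using q by (auto intro!: summable_mult summable_geometric)
  then have "(\<lambda>n. 2 * norm q ^ n) summable_on UNIV" "(\<lambda>n. 2 * norm q ^ Suc n) summable_on UNIV"
    by (auto simp: summable_on_UNIV_nonneg_real_iff simp del: power_Suc)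
  moreover have "nat \<bar>- 1 - int n\<bar> = Suc n" for n by simp
  ultimately have "g summable_on range int" "g summable_on range (\<lambda>n. - 1 - int n)"
    by (simp_all add: summable_on_reindex inj_on_def o_def g_def del: power_Suc)
  moreover have "range int \<inter> range (\<lambda>n. - 1 - int n) = {}" by auto
  moreover have "range int \<union> range (\<lambda>n. - 1 - int n) = UNIV"
  proof -
    have "k \<in> range int \<or> k \<in> range (\<lambda>n. - 1 - int n)" for k
      by (cases k) (auto intro: image_eqI[of _ _ "nat (- 1 - k)"])
    then show ?thesis by auto
  qed
  ultimately have "g summable_on UNIV"
    by (metis summable_on_Un_disjoint)
  then show "(\<lambda>k. norm (g k)) summable_on UNIV"
    by (simp add: g_def)
  fix k :: int
  have "norm q ^ nat (12 * k\<^sup>2 + k) \<le> norm q ^ nat \<bar>k\<bar>"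
    "norm q ^ nat (12 * k\<^sup>2 + 7 * k + 1) \<le> norm q ^ nat \<bar>k\<bar>"
    using q abs_le_theta_exponents[of k] by (auto intro!: power_decreasing)
  then show "norm (theta_term q k) \<le> norm (g k)"
    unfolding theta_term_def g_def
    by (intro order_trans[OF norm_triangle_ineq4]) (simp add: norm_power)
qed

text \<open>Tannery's theorem: the summands converge termwise, since \<open>qfact q n\<close> and
  \<open>qfact q (n - k)\<close> have the same limit, and are dominated by B^3 |q|^k uniformly in
  \<open>n\<close>.\<close>

lemma qbinomial_sum_limit_complex:
  "summable (\<lambda>k. q ^ (2 * k\<^sup>2) / qfact q (2 * k))" (is "summable ?a")
  "qbinomial_sum q \<longlonglongrightarrow> (\<Sum>k. q ^ (2 * k\<^sup>2) / qfact q (2 * k))"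
proof -
  obtain B where B: "B > 0" "\<And>n. norm (qfact q n) \<le> B" "\<And>n. norm (inverse (qfact q n)) \<le> B"
    using bounded_qfact_complex by metis
  have qbinomial_eq: "qbinomial q n k = qfact q n * inverse (qfact q k) * inverse (qfact q (n - k))"
    if "k \<le> n" for n k
    using qbinomial_qfact[OF that, of q] qfact_nonzero_complex[of k] qfact_nonzero_complex[of "n - k"]
    by (simp add: field_simps)
  have bound: "norm (qbinomial q n k) \<le> B * B * B" for n k
    using B by (cases "k \<le> n") (auto simp: qbinomial_eq qbinomial_eq_0 norm_mult intro!: mult_mono)
  have lim: "(\<lambda>n. qbinomial q n k) \<longlonglongrightarrow> inverse (qfact q k)" for k
  proof -
    have "(\<lambda>n. qfact q (n - k)) \<longlonglongrightarrow> qfact_inf q"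
      by (rule LIMSEQ_offset[where k = k]) (simp add: tendsto_qfact_complex)
    then have "(\<lambda>n. qfact q n * inverse (qfact q k) * inverse (qfact q (n - k))) \<longlonglongrightarrow>
        qfact_inf q * inverse (qfact q k) * inverse (qfact_inf q)"
      by (intro tendsto_intros tendsto_qfact_complex has_prod_qfact_inf_complex(2))
    moreover have "eventually (\<lambda>n. qfact q n * inverse (qfact q k) * inverse (qfact q (n - k)) =
        qbinomial q n k) sequentially"
      using eventually_ge_at_top[of k] by eventually_elim (simp add: qbinomial_eq)
    ultimately have "(\<lambda>n. qbinomial q n k) \<longlonglongrightarrow>
        qfact_inf q * inverse (qfact q k) * inverse (qfact_inf q)"
      by (rule Lim_transform_eventually)
    moreover have "qfact_inf q * inverse (qfact q k) * inverse (qfact_inf q) = inverse (qfact q k)"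
      using has_prod_qfact_inf_complex(2) by (simp add: field_simps)
    ultimately show ?thesis by simp
  qed
  let ?f = "\<lambda>k n. q ^ (2 * k\<^sup>2) * qbinomial q n (2 * k)"
  have "norm (?f k n) \<le> norm q ^ k * (B * B * B)" for k n
    unfolding norm_mult norm_power using q bound
    by (intro mult_mono power_decreasing) (auto simp: power2_eq_square)
  then have ev: "eventually (\<lambda>(k, n). norm (?f k n) \<le> norm q ^ k * (B * B * B)) (at_top \<times>\<^sub>F sequentially)"
    by (intro always_eventually) auto
  have "summable (\<lambda>k. norm q ^ k * (B * B * B))"
    using q by (intro summable_mult2 summable_geometric) simp
  from tannerys_theorem[OF tendsto_mult[OF tendsto_const lim] ev this]
  have *: "summable (\<lambda>k. norm (q ^ (2 * k\<^sup>2) * inverse (qfact q (2 * k))))"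
    "(\<lambda>n. \<Sum>k. ?f k n) \<longlonglongrightarrow> (\<Sum>k. q ^ (2 * k\<^sup>2) * inverse (qfact q (2 * k)))"
    by auto
  then show "summable ?a"
    by (simp add: divide_inverse summable_norm_cancel)
  have "(\<Sum>k. ?f k n) = qbinomial_sum q n" for n
    unfolding qbinomial_sum_def by (rule suminf_finite) (auto simp: qbinomial_eq_0)
  with *(2) show "qbinomial_sum q \<longlonglongrightarrow> suminf ?a"
    by (simp add: divide_inverse)
qed

end

text \<open>A square root \<open>p\<close> of \<open>q\<close> also has norm below 1, so every term
  of \<open>theta_defect_eq\<close> tends to 0.\<close>

lemma tendsto_theta_defect_complex:
  fixes q :: complex
  assumes "norm q < 1"
  shows "theta_defect q \<longlonglongrightarrow> 0"
proof -
  define p where "p = csqrt q"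
  have p: "p\<^sup>2 = q" by (simp add: p_def)
  have norm_p: "norm p < 1"
    using assms unfolding p[symmetric] norm_power by (simp add: power_less_one_iff abs_square_less_1)
  have quad: "filterlim (\<lambda>M::nat. 2 * (12 * M\<^sup>2 + 7 * M + 1)) at_top sequentially"
    by (rule filterlim_at_top_mono[OF filterlim_ident]) auto
  have lin: "filterlim (\<lambda>M::nat. 4 * M) at_top sequentially"
    by (rule filterlim_at_top_mono[OF filterlim_ident]) auto
  have "(\<lambda>M. 2 * p ^ (2 * (12 * M\<^sup>2 + 7 * M + 1)) + pent_err p (4 * M) + pent_err (- p) (4 * M)) \<longlonglongrightarrow> 2 * 0 + 0 + 0"
    using norm_p
    by (intro tendsto_intros filterlim_compose[OF _ quad] filterlim_compose[OF _ lin] LIMSEQ_power_zero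
        tendsto_pent_err_complex) auto
  then have "(\<lambda>M. 2 * theta_defect q M) \<longlonglongrightarrow> 2 * 0"
    by (simp only: theta_defect_eq[of p, unfolded p]) simp
  then show ?thesis
    by (subst (asm) tendsto_mult_left_iff) auto
qed

text \<open>The limit of \<open>theta_defect q\<close> is computed in two ways: it is 0, and it is
  the difference of the two sides multiplied by \<open>qfact_inf q\<close>.\<close>

lemma sums_theta_complex:
  fixes q :: complex
  assumes q: "norm q < 1"
  shows "(\<lambda>n. q ^ (2 * n\<^sup>2) / qfact q (2 * n)) sums
    (1 / qfact_inf q * (\<Sum>\<^sub>\<infinity>k\<in>(UNIV :: int set). theta_term q k))"
proof -
  let ?S = "\<Sum>n. q ^ (2 * n\<^sup>2) / qfact q (2 * n)"
  have double: "filterlim (\<lambda>M::nat. 2 * M) at_top sequentially"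
    by (rule filterlim_at_top_mono[OF filterlim_ident]) auto
  have "theta_defect q \<longlonglongrightarrow> qfact_inf q * ?S - infsum (theta_term q) UNIV"
    unfolding theta_defect_def[abs_def] using q
    by (intro tendsto_intros filterlim_compose[OF _ double] tendsto_qfact_complex qbinomial_sum_limit_complex(2)
        summable_on_imp_symmetric_limit theta_summable_complex)
  with tendsto_theta_defect_complex[OF q] have "qfact_inf q * ?S = infsum (theta_term q) UNIV"
    using LIMSEQ_unique by fastforce
  then have "?S = 1 / qfact_inf q * infsum (theta_term q) UNIV"
    using has_prod_qfact_inf_complex(2)[OF q] by (simp add: field_simps)
  with summable_sums[OF qbinomial_sum_limit_complex(1)[OF q]] show ?thesis by simp
qed

subsection \<open>Limits for formal power series\<close>

text \<open>Coefficient \<open>n\<close> of a product involves only coefficients up to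
  \<open>n\<close> of the factors, and these finitely many are eventually constant.\<close>

lemma tendsto_mult_fps:
  fixes f g :: "'b \<Rightarrow> 'a::ring fps"
  assumes "(f \<longlongrightarrow> a) F" "(g \<longlongrightarrow> b) F"
  shows "((\<lambda>x. f x * g x) \<longlongrightarrow> a * b) F"
proof (rule tendsto_fpsI)
  fix n
  have "eventually (\<lambda>x. \<forall>i\<in>{..n}. f x $ i = a $ i \<and> g x $ i = b $ i) F"
    using assms by (auto simp: eventually_ball_finite_distrib tendsto_fps_iff eventually_conj_iff)
  then show "eventually (\<lambda>x. (f x * g x) $ n = (a * b) $ n) F"
    by eventually_elim (auto simp: fps_mult_nth intro!: sum.cong)
qed

lemma tendsto_diff_fps:
  fixes f g :: "'b \<Rightarrow> 'a::group_add fps"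
  assumes "(f \<longlongrightarrow> a) F" "(g \<longlongrightarrow> b) F"
  shows "((\<lambda>x. f x - g x) \<longlongrightarrow> a - b) F"
proof (rule tendsto_fpsI)
  fix n
  from assms have "eventually (\<lambda>x. f x $ n = a $ n) F" "eventually (\<lambda>x. g x $ n = b $ n) F"
    by (simp_all add: tendsto_fps_iff)
  then show "eventually (\<lambda>x. (f x - g x) $ n = (a - b) $ n) F"
    by eventually_elim simp
qed

lemma fps_X_power_dvd_imp_nth_eq_0:
  fixes f :: "'a::comm_ring_1 fps"
  assumes "fps_X ^ n dvd f" "i < n"
  shows "f $ i = 0"
  using assms by (auto elim!: dvdE simp: fps_X_power_mult_nth)

text \<open>The way back from \<open>fps_X^2\<close> to \<open>fps_X\<close>, which itself has no
  square root to serve as \<open>p\<close>.\<close>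

lemma fps_compose_X_square_nth: "((f :: 'a::comm_ring_1 fps) oo fps_X\<^sup>2) $ (2 * i) = f $ i"
  by (simp add: fps_compose_nth fps_X_power_nth sum.delta' if_distrib flip: power_mult cong: if_cong)

lemma qfact_fps_X_nth_0: "qfact (fps_X :: 'a::comm_ring_1 fps) n $ 0 = 1"
  by (induction n) simp_all

text \<open>Factors \<open>1 - fps_X ^ j\<close> with \<open>j > i\<close> leave coefficient
  \<open>i\<close> unchanged.\<close>

lemma qfact_fps_X_nth: "i \<le> n \<Longrightarrow> qfact (fps_X :: 'a::comm_ring_1 fps) n $ i = qfact fps_X i $ i"
proof (induction n rule: dec_induct)
  case (step n)
  then show ?case
    by (simp add: right_diff_distrib fps_X_power_mult_right_nth del: power_Suc)
qed simp

lemma has_prod_qfact_inf_fps: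
  "(\<lambda>j. 1 - (fps_X :: complex fps) ^ Suc j) has_prod qfact_inf fps_X" "qfact_inf (fps_X :: complex fps) $ 0 = 1"
proof -
  \<comment> \<open>The diagonal collects the stable value of each coefficient.\<close>
  define P where "P = Abs_fps (\<lambda>i. qfact (fps_X :: complex fps) i $ i)"
  have "(\<lambda>n. qfact fps_X (Suc n)) \<longlonglongrightarrow> P"
  proof (rule tendsto_fpsI)
    fix i
    show "eventually (\<lambda>n. qfact fps_X (Suc n) $ i = P $ i) sequentially"
      using eventually_ge_at_top[of i]
      by eventually_elim (simp only: P_def fps_nth_Abs_fps qfact_fps_X_nth[OF le_SucI])
  qed
  then have "(\<lambda>n. \<Prod>j\<le>n. 1 - fps_X ^ Suc (j + 0)) \<longlonglongrightarrow> P"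
    by (simp only: qfact_eq_prod_lessThan lessThan_Suc_atMost add_0_right)
  moreover have P0: "P $ 0 = 1"
    by (simp add: P_def)
  \<comment> \<open>\<open>raw_has_prod\<close> demands a nonzero limit.\<close>
  moreover from P0 have "P \<noteq> 0"
    by force
  ultimately have P: "(\<lambda>j. 1 - fps_X ^ Suc j) has_prod P"
    unfolding has_prod_def raw_has_prod_def by blast
  have eq: "qfact_inf fps_X = P"
    unfolding qfact_inf_def by (rule has_prod_unique[OF P, symmetric])
  show "(\<lambda>j. 1 - (fps_X :: complex fps) ^ Suc j) has_prod qfact_inf fps_X"
    unfolding eq by (rule P)
  show "qfact_inf (fps_X :: complex fps) $ 0 = 1"
    unfolding eq by (rule P0)
qed

lemma tendsto_qfact_fps: "qfact (fps_X :: complex fps) \<longlonglongrightarrow> qfact_inf fps_X"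
  using has_prod_imp_tendsto'[OF has_prod_qfact_inf_fps(1)]
  by (simp add: qfact_eq_prod_lessThan[abs_def])

lemma theta_summable_fps: "theta_term (fps_X :: complex fps) summable_on UNIV"
proof (rule has_sum_imp_summable, rule has_sum_fpsI)
  fix n
  have "{k \<in> UNIV. theta_term (fps_X :: complex fps) k $ n \<noteq> 0} \<subseteq> {- int n..int n}"
  proof
    fix k assume "k \<in> {k \<in> UNIV. theta_term (fps_X :: complex fps) k $ n \<noteq> 0}"
    then have "n = nat (12 * k\<^sup>2 + k) \<or> n = nat (12 * k\<^sup>2 + 7 * k + 1)"
      by (auto simp: theta_term_def fps_X_power_nth split: if_splits)
    with abs_le_theta_exponents[of k] have "nat \<bar>k\<bar> \<le> n" by auto
    then show "k \<in> {- int n..int n}" by auto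
  qed
  then show "finite {k \<in> UNIV. theta_term (fps_X :: complex fps) k $ n \<noteq> 0}"
    by (rule finite_subset) simp
  show "Abs_fps (\<lambda>n. \<Sum>k | k \<in> UNIV \<and> theta_term (fps_X :: complex fps) k $ n \<noteq> 0. theta_term fps_X k $ n) $ n =
    (\<Sum>k | k \<in> UNIV \<and> theta_term (fps_X :: complex fps) k $ n \<noteq> 0. theta_term fps_X k $ n)"
    by simp
qed

text \<open>As over the complex numbers, two equal limits cancel; the inverses are genuine because
  all constant coefficients are 1.\<close>

lemma tendsto_qbinomial_fps:
  "(\<lambda>n. qbinomial (fps_X :: complex fps) n k) \<longlonglongrightarrow> inverse (qfact fps_X k)"
proof -
  let ?q = "fps_X :: complex fps"
  have inv: "qfact ?q n * inverse (qfact ?q n) = 1" for n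
    by (simp add: inverse_mult_eq_1' qfact_fps_X_nth_0)
  have "(\<lambda>n. qfact ?q (n - k)) \<longlonglongrightarrow> qfact_inf ?q"
    by (rule LIMSEQ_offset[where k = k]) (simp add: tendsto_qfact_fps)
  then have "(\<lambda>n. qfact ?q n * inverse (qfact ?q k) * inverse (qfact ?q (n - k))) \<longlonglongrightarrow>
      qfact_inf ?q * inverse (qfact ?q k) * inverse (qfact_inf ?q)"
    by (intro tendsto_mult_fps tendsto_const tendsto_inverse_fps tendsto_qfact_fps)
       (simp_all add: has_prod_qfact_inf_fps(2))
  moreover have "eventually (\<lambda>n. qfact ?q n * inverse (qfact ?q k) * inverse (qfact ?q (n - k)) =
      qbinomial ?q n k) sequentially"
    using eventually_ge_at_top[of k]
  proof eventually_elim
    case (elim n)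
    have "qfact ?q n * inverse (qfact ?q k) * inverse (qfact ?q (n - k)) =
        qbinomial ?q n k * (qfact ?q k * inverse (qfact ?q k)) *
        (qfact ?q (n - k) * inverse (qfact ?q (n - k)))"
      by (simp only: qbinomial_qfact[OF elim, symmetric] mult_ac)
    then show ?case by (simp add: inv)
  qed
  ultimately have "(\<lambda>n. qbinomial ?q n k) \<longlonglongrightarrow>
      qfact_inf ?q * inverse (qfact ?q k) * inverse (qfact_inf ?q)"
    by (rule Lim_transform_eventually)
  moreover have "qfact_inf ?q * inverse (qfact_inf ?q) = 1"
    by (simp add: inverse_mult_eq_1' has_prod_qfact_inf_fps(2))
  then have "qfact_inf ?q * inverse (qfact ?q k) * inverse (qfact_inf ?q) = inverse (qfact ?q k)"
    by (simp add: mult.commute[of "qfact_inf ?q"] mult.assoc)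
  ultimately show ?thesis by simp
qed

text \<open>The factor \<open>fps_X ^ (2 * k^2)\<close> confines the contributions to coefficient
  \<open>i\<close> to \<open>k <= i\<close>, so both limits reduce to one finite sum per
  coefficient.\<close>

lemma qbinomial_sum_limit_fps:
  defines "a \<equiv> (\<lambda>k. (fps_X :: complex fps) ^ (2 * k\<^sup>2) / qfact fps_X (2 * k))"
  obtains S where "a sums S" "qbinomial_sum (fps_X :: complex fps) \<longlonglongrightarrow> S"
proof -
  have a: "a k = fps_X ^ (2 * k\<^sup>2) * inverse (qfact fps_X (2 * k))" for k
    by (simp add: a_def fps_divide_unit qfact_fps_X_nth_0)
  have vanish: "(fps_X ^ (2 * k\<^sup>2) * f) $ i = 0" if "i < k" for i k and f :: "complex fps"
  proof -
    have "k \<le> 2 * k\<^sup>2" by (simp add: power2_eq_square)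
    with that have "i < 2 * k\<^sup>2" by simp
    then show ?thesis by (simp add: fps_X_power_mult_nth)
  qed
  define S where "S = Abs_fps (\<lambda>i. \<Sum>k\<le>i. a k $ i)"
  have cut: "(\<Sum>k\<in>K. (fps_X ^ (2 * k\<^sup>2) * f k) $ i) = (\<Sum>k\<le>i. (fps_X ^ (2 * k\<^sup>2) * f k) $ i)"
    if "{..i} \<subseteq> K" "finite K" for K i and f :: "nat \<Rightarrow> complex fps"
    using that by (intro sum.mono_neutral_right) (auto intro!: vanish)
  have "a sums S"
    unfolding sums_def
  proof (rule tendsto_fpsI)
    fix i
    show "eventually (\<lambda>n. (\<Sum>k<n. a k) $ i = S $ i) sequentially"
      using eventually_gt_at_top[of i]
      by eventually_elim (auto simp: fps_sum_nth S_def a intro!: cut)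
  qed
  moreover have "qbinomial_sum (fps_X :: complex fps) \<longlonglongrightarrow> S"
  proof (rule tendsto_fpsI)
    fix i
    have "(\<lambda>n. fps_X ^ (2 * k\<^sup>2) * qbinomial fps_X n (2 * k)) \<longlonglongrightarrow> a k" for k
      unfolding a by (intro tendsto_mult_fps tendsto_const tendsto_qbinomial_fps)
    then have "eventually (\<lambda>n. \<forall>k\<in>{..i}. (fps_X ^ (2 * k\<^sup>2) * qbinomial fps_X n (2 * k)) $ i = a k $ i) sequentially"
      by (auto simp: eventually_ball_finite_distrib tendsto_fps_iff)
    with eventually_ge_at_top[of i]
    show "eventually (\<lambda>n. qbinomial_sum fps_X n $ i = S $ i) sequentially"
    proof eventually_elim
      case (elim n)
      have "qbinomial_sum (fps_X :: complex fps) n $ i = (\<Sum>k\<le>n. (fps_X ^ (2 * k\<^sup>2) * qbinomial fps_X n (2 * k)) $ i)"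
        by (simp add: qbinomial_sum_def fps_sum_nth)
      also have "\<dots> = (\<Sum>k\<le>i. (fps_X ^ (2 * k\<^sup>2) * qbinomial fps_X n (2 * k)) $ i)"
        using elim(1) by (intro cut[of i "{..n}" "\<lambda>k. qbinomial fps_X n (2 * k)"]) auto
      also have "\<dots> = S $ i" using elim by (simp add: S_def)
      finally show ?case .
    qed
  qed
  ultimately show ?thesis by (rule that)
qed

section \<open>Substitution of a power series without constant term\<close>

context
  fixes c :: "'a::idom fps"
  assumes c: "c $ 0 = 0"
begin

lemma fps_compose_X_power: "fps_X ^ n oo c = c ^ n"
  using fps_compose_power[OF c, of fps_X n] by (simp add: c)

lemma fps_compose_qfact: "qfact fps_X n oo c = qfact c n"
  by (simp add: qfact_def fps_compose_prod_distrib[OF c] fps_compose_sub_distrib fps_compose_X_power)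

lemma fps_compose_qbinomial: "qbinomial fps_X n k oo c = qbinomial c n k"
proof (induction n arbitrary: k)
  case 0
  then show ?case by (cases k) simp_all
next
  case (Suc n)
  then show ?case
    by (cases k) (simp_all add: fps_compose_add_distrib fps_compose_mult_distrib[OF c] fps_compose_X_power)
qed

text \<open>\<open>theta_defect\<close> is a polynomial expression in its argument, so substitution
  passes through it.\<close>

lemma fps_compose_theta_defect: "theta_defect fps_X M oo c = theta_defect c M"
  by (simp add: theta_defect_def qbinomial_sum_def theta_term_def fps_compose_sub_distrib
      fps_compose_sum_distrib fps_compose_mult_distrib[OF c] fps_compose_X_power
      fps_compose_qfact fps_compose_qbinomial)

end

text \<open>With \<open>p = fps_X\<close> the right side of \<open>theta_defect_eq\<close> is
  divisible by \<open>fps_X ^ (4 * M)\<close>. For \<open>i < M\<close> this annihilates coefficient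
  \<open>2 * i\<close> at \<open>fps_X^2\<close>, which is coefficient \<open>i\<close> at
  \<open>fps_X\<close>.\<close>

lemma tendsto_theta_defect_fps: "theta_defect (fps_X :: complex fps) \<longlonglongrightarrow> 0"
proof (rule tendsto_fpsI)
  fix i
  show "eventually (\<lambda>M. theta_defect (fps_X :: complex fps) M $ i = 0 $ i) sequentially"
    using eventually_gt_at_top[of i]
  proof eventually_elim
    case (elim M)
    let ?X = "fps_X :: complex fps"
    have "?X ^ (4 * M) dvd (- ?X) ^ (4 * M)"
      by (rule dvd_power_same) simp
    then have "?X ^ (4 * M) dvd pent_err (- ?X) (4 * M)"
      using power_dvd_pent_err dvd_trans by blast
    moreover have "?X ^ (4 * M) dvd ?X ^ (2 * (12 * M\<^sup>2 + 7 * M + 1))"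
      by (rule le_imp_power_dvd) simp
    ultimately have "?X ^ (4 * M) dvd 2 * theta_defect (?X\<^sup>2) M"
      unfolding theta_defect_eq by (intro dvd_add dvd_mult power_dvd_pent_err)
    then have "(2 * theta_defect (?X\<^sup>2) M) $ (2 * i) = 0"
      by (rule fps_X_power_dvd_imp_nth_eq_0) (use elim in simp)
    then have "2 * (theta_defect (?X\<^sup>2) M $ (2 * i)) = 0"
      by (simp only: mult_2 fps_add_nth)
    then have "theta_defect (?X\<^sup>2) M $ (2 * i) = 0"
      by simp
    moreover have "theta_defect ?X M oo ?X\<^sup>2 = theta_defect (?X\<^sup>2) M"
      by (rule fps_compose_theta_defect) simp
    ultimately show ?case
      using fps_compose_X_square_nth[of "theta_defect ?X M" i] by simp
  qed
qed

lemma sums_theta_fps: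
  "(\<lambda>n. (fps_X :: complex fps) ^ (2 * n\<^sup>2) / qfact fps_X (2 * n)) sums
    (1 / qfact_inf fps_X * (\<Sum>\<^sub>\<infinity>k\<in>(UNIV :: int set). theta_term fps_X k))"
proof -
  let ?P = "qfact_inf (fps_X :: complex fps)"
  obtain S where S: "(\<lambda>n. (fps_X :: complex fps) ^ (2 * n\<^sup>2) / qfact fps_X (2 * n)) sums S"
    "qbinomial_sum (fps_X :: complex fps) \<longlonglongrightarrow> S"
    using qbinomial_sum_limit_fps by metis
  have double: "filterlim (\<lambda>M::nat. 2 * M) at_top sequentially"
    by (rule filterlim_at_top_mono[OF filterlim_ident]) auto
  have "theta_defect (fps_X :: complex fps) \<longlonglongrightarrow> ?P * S - infsum (theta_term fps_X) UNIV"
    unfolding theta_defect_def[abs_def]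
    by (intro tendsto_diff_fps tendsto_mult_fps filterlim_compose[OF _ double] tendsto_qfact_fps S(2)
        summable_on_imp_symmetric_limit theta_summable_fps)
  with tendsto_theta_defect_fps have "?P * S = infsum (theta_term fps_X) UNIV"
    using LIMSEQ_unique by fastforce
  then have "1 / ?P * infsum (theta_term fps_X) UNIV = inverse ?P * ?P * S"
    by (simp add: fps_divide_unit has_prod_qfact_inf_fps(2))
  also have "\<dots> = S"
    by (simp add: inverse_mult_eq_1 has_prod_qfact_inf_fps(2))
  finally show ?thesis using S(1) by simp
qed

theorem corollary5p5:
  shows "(\<lambda>n. (fps_X :: complex fps) ^ (2 * n\<^sup>2) / qfact fps_X (2 * n)) sums
           (1 / qfact_inf fps_X * (\<Sum>\<^sub>\<infinity>k\<in>(UNIV :: int set). theta_term fps_X k)) \<and>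
         (\<forall>q::complex. norm q < 1 \<longrightarrow>
           (\<lambda>n. q ^ (2 * n\<^sup>2) / qfact q (2 * n)) sums
             (1 / qfact_inf q * (\<Sum>\<^sub>\<infinity>k\<in>(UNIV :: int set). theta_term q k)))"
  using sums_theta_fps sums_theta_complex by blast

end
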